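(* Let $\alpha_1,\alpha_2,\beta_1,\beta_2,\beta_3\in(0,+\infty)$. Consider the polynomials $$\mathbf{L}_n(x)={}_3F_3(-n,\alpha_1,\alpha_2;\beta_1,\beta_2,\beta_3;x),\qquad n\in\mathbb{Z}_+,$$ with $\mathbf{L}_{-1}(x)=\mathbf{L}_{-2}(x)=\mathbf{L}_{-3}(x)\equiv0$. Let $b_j=\beta_j-1$ ($j=1,2,3$) and $$c=b_1+b_2+b_3+6,\qquad \widehat b=7+3(b_1+b_2+b_3)+b_1b_2+b_1b_3+b_2b_3,$$ $$d=1+b_1+b_2+b_3+b_1b_2+b_1b_3+b_2b_3+b_1b_2b_3,\qquad \widehat\alpha=1+\alpha_1+\alpha_2.$$ Then the following five-term recurrence relation holds for all $k\in\mathbb{Z}_+$ (and all $x\in\mathbb{C}$): $$\left(-k(k-1)(k-2)-k(k-1)c-k\widehat b-d\right)\mathbf{L}_{k+1}(x)+\left(4k(k-1)(k-2)+3k(k-1)c+2k\widehat b+d\right)\mathbf{L}_k(x)$$ $$+\left(-6k(k-1)(k-2)-3k(k-1)c-k\widehat b\right)\mathbf{L}_{k-1}(x)+\left(4k(k-1)(k-2)+k(k-1)c\right)\mathbf{L}_{k-2}(x)-k(k-1)(k-2)\mathbf{L}_{k-3}(x)$$ $$=x\left[\left(k(k-1)+k\widehat\alpha+\alpha_1\alpha_2\right)\mathbf{L}_k(x)-\left(2k(k-1)+k\widehat\alpha\right)\mathbf{L}_{k-1}(x)+k(k-1)\mathbf{L}_{k-2}(x)\right].$$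
   Context: $\mathbb{Z}_+$ is the set of non-negative integers. The Pochhammer symbol is $(c)_0=1$, $(c)_k=c(c+1)\cdots(c+k-1)$ for $k\ge1$. The generalized hypergeometric function is $${}_mF_n(a_1,\dots,a_m;b_1,\dots,b_n;x)=\sum_{k=0}^\infty\frac{(a_1)_k\cdots(a_m)_k}{(b_1)_k\cdots(b_n)_k}\frac{x^k}{k!};$$ when an upper parameter is $-n$ with $n\in\mathbb{Z}_+$ it is a polynomial in $x$ (sum over $0\le k\le n$). *)

theory Defs
  imports "HOL-Analysis.Analysis"
begin

text \<open>
  The library's \<open>fps_hypergeo as bs c\<close> is the formal power series with coefficients
  \<open>(\<Prod>a. pochhammer a k) * c ^ k / ((\<Prod>b. pochhammer b k) * fact k)\<close>, so \<open>c = 1\<close> gives the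
  generalized hypergeometric series itself. The value is meaningful where the series
  converges; if an upper parameter is \<open>-n\<close>, the series is a finite sum over \<open>0 \<le> k \<le> n\<close>.
\<close>

definition hypergeom :: "complex list \<Rightarrow> complex list \<Rightarrow> complex \<Rightarrow> complex" where
  "hypergeom as bs x = eval_fps (fps_hypergeo as bs 1) x"

definition L_poly ::
  "real \<Rightarrow> real \<Rightarrow> real \<Rightarrow> real \<Rightarrow> real \<Rightarrow> int \<Rightarrow> complex \<Rightarrow> complex" where
  "L_poly \<alpha>1 \<alpha>2 \<beta>1 \<beta>2 \<beta>3 n x =
     (if n < 0 then 0
      else hypergeom [- of_int n, of_real \<alpha>1, of_real \<alpha>2]
                     [of_real \<beta>1, of_real \<beta>2, of_real \<beta>3] x)"

end

theory Submission
  imports Defs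
begin

text \<open>
  Since \<open>(-n)\<^sub>i / i! = (-1)\<^sup>i (n choose i)\<close>, the polynomials are binomial transforms in \<open>n\<close>
  of the sequence \<open>t\<^sub>i = (-x)\<^sup>i (\<alpha>\<^sub>1)\<^sub>i (\<alpha>\<^sub>2)\<^sub>i / ((\<beta>\<^sub>1)\<^sub>i (\<beta>\<^sub>2)\<^sub>i (\<beta>\<^sub>3)\<^sub>i)\<close>. Under this transform the
  backward difference at \<open>n + 1\<close> is the shift \<open>t\<^sub>i \<mapsto> t\<^bsub>i+1\<^esub>\<close>, and \<open>n\<close> times the backward
  difference at \<open>n\<close> is multiplication of \<open>t\<^sub>i\<close> by \<open>i\<close>. Both sides of the recurrence are linear
  combinations of iterated differences, so it becomes the termwise identity
  \<open>-(\<beta>\<^sub>1+i)(\<beta>\<^sub>2+i)(\<beta>\<^sub>3+i) t\<^bsub>i+1\<^esub> = x (\<alpha>\<^sub>1+i)(\<alpha>\<^sub>2+i) t\<^sub>i\<close>.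
\<close>

text \<open>Integer indices with value 0 below zero match the convention of \<open>L_poly\<close>,
  and make the backward-difference identities hold for every integer \<open>n\<close>.\<close>

definition binomial_transform :: "(nat \<Rightarrow> 'a::comm_ring_1) \<Rightarrow> int \<Rightarrow> 'a" where
  "binomial_transform s n =
     (if n < 0 then 0 else \<Sum>i\<le>nat n. of_nat (nat n choose i) * s i)"

lemma binomial_transform_neg [simp]: "n < 0 \<Longrightarrow> binomial_transform s n = 0"
  by (simp add: binomial_transform_def)

lemma binomial_transform_of_nat:
  "binomial_transform s (int n) = (\<Sum>i\<le>n. of_nat (n choose i) * s i)"
  by (simp add: binomial_transform_def)

lemma binomial_transform_add:
  "binomial_transform (\<lambda>i. s i + t i) n = binomial_transform s n + binomial_transform t n"
  by (simp add: binomial_transform_def algebra_simps sum.distrib)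

lemma binomial_transform_cmult:
  "binomial_transform (\<lambda>i. a * s i) n = a * binomial_transform s n"
  by (simp add: binomial_transform_def sum_distrib_left mult.left_commute)

text \<open>Pascal's rule. The sign condition matters at \<open>n = -1\<close>, where the left side
  is \<open>s 0\<close> and the right side is 0.\<close>

lemma binomial_transform_diff_shift:
  assumes "n \<ge> 0"
  shows "binomial_transform s (n + 1) - binomial_transform s n
           = binomial_transform (\<lambda>i. s (Suc i)) n"
proof -
  obtain m where m: "n = int m"
    using assms nonneg_int_cases by blast
  have "(\<Sum>i\<le>Suc m. of_nat (Suc m choose i) * s i)
      = s 0 + (\<Sum>i\<le>m. of_nat (Suc m choose Suc i) * s (Suc i))"
    by (subst sum.atMost_Suc_shift) simp
  also have "\<dots> = (\<Sum>i\<le>m. of_nat (m choose i) * s (Suc i))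
      + (s 0 + (\<Sum>i\<le>m. of_nat (m choose Suc i) * s (Suc i)))"
    by (simp add: sum.distrib algebra_simps)
  also have "s 0 + (\<Sum>i\<le>m. of_nat (m choose Suc i) * s (Suc i))
      = (\<Sum>i\<le>Suc m. of_nat (m choose i) * s i)"
    by (subst sum.atMost_Suc_shift) simp
  also have "\<dots> = (\<Sum>i\<le>m. of_nat (m choose i) * s i)"
    by (simp add: binomial_eq_0)
  finally show ?thesis
    using binomial_transform_of_nat[of s "Suc m"]
    by (simp add: m binomial_transform_of_nat add.commute)
qed

text \<open>Absorption, \<open>(i+1) * (m+1 choose i+1) = (m+1) * (m choose i)\<close>, followed by
  the shift rule at \<open>n - 1\<close>. At \<open>n = 0\<close>, where the shift rule may fail,
  the factor \<open>n\<close> vanishes.\<close>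

lemma binomial_transform_backward_diff:
  "of_int n * (binomial_transform s n - binomial_transform s (n - 1))
     = binomial_transform (\<lambda>i. of_nat i * s i) n"
proof (cases "n \<le> 0")
  case True
  then consider "n < 0" | "n = 0" by linarith
  then show ?thesis
    by cases (simp_all add: binomial_transform_def)
next
  case False
  then obtain m where m: "n = int m + 1"
    using nonneg_int_cases[of "n - 1"] by (metis diff_add_cancel diff_ge_0_iff_ge int_one_le_iff_zero_less not_le)
  have "of_nat (Suc m choose Suc i) * of_nat (Suc i) = (of_nat (Suc m) * of_nat (m choose i) :: 'a)" for i
    unfolding of_nat_mult[symmetric] by (simp only: Suc_times_binomial[symmetric] mult.commute)
  then have "of_nat (Suc m choose Suc i) * (of_nat (Suc i) * s (Suc i))
      = of_nat (Suc m) * (of_nat (m choose i) * s (Suc i))" for i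
    by (simp only: mult.assoc[symmetric])
  then have "(\<Sum>i\<le>Suc m. of_nat (Suc m choose i) * (of_nat i * s i))
      = of_nat (Suc m) * (\<Sum>i\<le>m. of_nat (m choose i) * s (Suc i))"
    by (subst sum.atMost_Suc_shift) (simp add: sum_distrib_left del: binomial_Suc_Suc of_nat_Suc)
  then show ?thesis
    using binomial_transform_diff_shift[of "int m" s]
      binomial_transform_of_nat[of "\<lambda>i. of_nat i * s i" "Suc m"]
    by (simp add: m binomial_transform_of_nat add.commute)
qed

text \<open>Write \<open>i * (i-1) * s i\<close> as \<open>i * t i - t i\<close> with
  \<open>t i = i * s i\<close>, and use the first-order rule for \<open>t\<close> at
  \<open>n\<close>, then for \<open>s\<close> at \<open>n\<close> and \<open>n - 1\<close>.\<close>

lemma binomial_transform_backward_diff2: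
  "of_int n * (of_int n - 1) * (binomial_transform s n - 2 * binomial_transform s (n - 1)
       + binomial_transform s (n - 2))
     = binomial_transform (\<lambda>i. of_nat i * (of_nat i - 1) * s i) n"
proof -
  let ?B = binomial_transform
  let ?t = "\<lambda>i. of_nat i * s i"
  have "?B (\<lambda>i. of_nat i * (of_nat i - 1) * s i) n = ?B (\<lambda>i. of_nat i * ?t i) n - ?B ?t n"
    using binomial_transform_add[of "\<lambda>i. of_nat i * ?t i" "\<lambda>i. (-1) * ?t i" n]
      binomial_transform_cmult[of "-1" ?t n]
    by (simp add: algebra_simps)
  also have "\<dots> = of_int n * (?B ?t n - ?B ?t (n - 1)) - ?B ?t n"
    by (simp only: binomial_transform_backward_diff)
  also have "?B ?t n = of_int n * (?B s n - ?B s (n - 1))"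
    by (simp only: binomial_transform_backward_diff)
  also have "?B ?t (n - 1) = (of_int n - 1) * (?B s (n - 1) - ?B s (n - 2))"
    using binomial_transform_backward_diff[of "n - 1" s] by simp
  finally show ?thesis
    by (simp add: algebra_simps)
qed

text \<open>The same induction step once more: the factor \<open>i - 2\<close> contributes
  \<open>i * t i - 2 * t i\<close> with \<open>t i = i * (i-1) * s i\<close>.\<close>

lemma binomial_transform_backward_diff3:
  "of_int n * (of_int n - 1) * (of_int n - 2) * (binomial_transform s n
       - 3 * binomial_transform s (n - 1) + 3 * binomial_transform s (n - 2)
       - binomial_transform s (n - 3))
     = binomial_transform (\<lambda>i. of_nat i * (of_nat i - 1) * (of_nat i - 2) * s i) n"
proof -
  let ?B = binomial_transform
  let ?t = "\<lambda>i. of_nat i * (of_nat i - 1) * s i"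
  have "?B (\<lambda>i. of_nat i * (of_nat i - 1) * (of_nat i - 2) * s i) n
      = ?B (\<lambda>i. of_nat i * ?t i) n - 2 * ?B ?t n"
    using binomial_transform_add[of "\<lambda>i. of_nat i * ?t i" "\<lambda>i. (-2) * ?t i" n]
      binomial_transform_cmult[of "-2" ?t n]
    by (simp add: algebra_simps)
  also have "\<dots> = of_int n * (?B ?t n - ?B ?t (n - 1)) - 2 * ?B ?t n"
    by (simp only: binomial_transform_backward_diff)
  also have "?B ?t n
      = of_int n * (of_int n - 1) * (?B s n - 2 * ?B s (n - 1) + ?B s (n - 2))"
    by (simp only: binomial_transform_backward_diff2)
  also have "?B ?t (n - 1) = (of_int n - 1) * (of_int n - 2)
      * (?B s (n - 1) - 2 * ?B s (n - 2) + ?B s (n - 3))"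
    using binomial_transform_backward_diff2[of "n - 1" s] by (simp add: algebra_simps)
  finally show ?thesis
    by (simp add: algebra_simps)
qed

lemma L_poly_eq_binomial_transform:
  "L_poly \<alpha>1 \<alpha>2 \<beta>1 \<beta>2 \<beta>3 n x = binomial_transform
     (\<lambda>i. (- x) ^ i * (pochhammer (of_real \<alpha>1) i * pochhammer (of_real \<alpha>2) i)
        / (pochhammer (of_real \<beta>1) i * pochhammer (of_real \<beta>2) i * pochhammer (of_real \<beta>3) i)) n"
  (is "_ = binomial_transform ?t n")
proof (cases "n < 0")
  case True
  then show ?thesis by (simp add: L_poly_def)
next
  case False
  then obtain m where m: "n = int m"
    using nonneg_int_cases by (metis not_le)
  have poch: "pochhammer (- of_nat m) i / fact i = (-1) ^ i * (of_nat (m choose i) :: complex)"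
    for i
    using gbinomial_pochhammer[of "of_nat m :: complex" i]
    by (simp add: binomial_gbinomial mult.assoc[symmetric] power_mult_distrib[symmetric])
  let ?F = "fps_hypergeo [- of_nat m, of_real \<alpha>1, of_real \<alpha>2]
    [of_real \<beta>1, of_real \<beta>2, of_real \<beta>3] (1 :: complex)"
  have coeff: "fps_nth ?F i * x ^ i = of_nat (m choose i) * ?t i" for i
  proof -
    have "fps_nth ?F i * x ^ i
        = (pochhammer (- of_nat m) i / fact i) * x ^ i
            * (pochhammer (of_real \<alpha>1) i * pochhammer (of_real \<alpha>2) i)
            / (pochhammer (of_real \<beta>1) i * pochhammer (of_real \<beta>2) i * pochhammer (of_real \<beta>3) i)"
      by (simp add: mult_ac)
    also have "\<dots> = of_nat (m choose i) * ?t i"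
      unfolding poch by (subst power_minus[of x]) simp
    finally show ?thesis .
  qed
  \<comment> \<open>The power series terminates because \<open>m choose i\<close> is 0 for
    \<open>i > m\<close>.\<close>
  have "eval_fps ?F x = (\<Sum>i\<le>m. of_nat (m choose i) * ?t i)"
    unfolding eval_fps_def coeff
    by (rule suminf_finite) (auto simp: binomial_eq_0)
  then show ?thesis
    by (simp add: m L_poly_def hypergeom_def binomial_transform_of_nat)
qed

theorem theorem4:
  fixes \<alpha>1 \<alpha>2 \<beta>1 \<beta>2 \<beta>3 b1 b2 b3 c b_hat d \<alpha>_hat :: real
    and L :: "int \<Rightarrow> complex \<Rightarrow> complex"
    and k :: nat and x :: complex
  assumes "\<alpha>1 > 0" and "\<alpha>2 > 0" and "\<beta>1 > 0" and "\<beta>2 > 0" and "\<beta>3 > 0"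
    and "L = L_poly \<alpha>1 \<alpha>2 \<beta>1 \<beta>2 \<beta>3"
    and "b1 = \<beta>1 - 1" and "b2 = \<beta>2 - 1" and "b3 = \<beta>3 - 1"
    and "c = b1 + b2 + b3 + 6"
    and "b_hat = 7 + 3 * (b1 + b2 + b3) + b1 * b2 + b1 * b3 + b2 * b3"
    and "d = 1 + b1 + b2 + b3 + b1 * b2 + b1 * b3 + b2 * b3 + b1 * b2 * b3"
    and "\<alpha>_hat = 1 + \<alpha>1 + \<alpha>2"
  shows
    "complex_of_real (- real k * (real k - 1) * (real k - 2) - real k * (real k - 1) * c
         - real k * b_hat - d) * L (int k + 1) x
     + complex_of_real (4 * real k * (real k - 1) * (real k - 2) + 3 * real k * (real k - 1) * c
         + 2 * real k * b_hat + d) * L (int k) x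
     + complex_of_real (- 6 * real k * (real k - 1) * (real k - 2) - 3 * real k * (real k - 1) * c
         - real k * b_hat) * L (int k - 1) x
     + complex_of_real (4 * real k * (real k - 1) * (real k - 2)
         + real k * (real k - 1) * c) * L (int k - 2) x
     - complex_of_real (real k * (real k - 1) * (real k - 2)) * L (int k - 3) x
     = x * (complex_of_real (real k * (real k - 1) + real k * \<alpha>_hat + \<alpha>1 * \<alpha>2) * L (int k) x
            - complex_of_real (2 * real k * (real k - 1) + real k * \<alpha>_hat) * L (int k - 1) x
            + complex_of_real (real k * (real k - 1)) * L (int k - 2) x)"
proof -
  define t :: "nat \<Rightarrow> complex" where
    "t = (\<lambda>i. (- x) ^ i * (pochhammer (of_real \<alpha>1) i * pochhammer (of_real \<alpha>2) i)
        / (pochhammer (of_real \<beta>1) i * pochhammer (of_real \<beta>2) i * pochhammer (of_real \<beta>3) i))"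
  define s where "s = (\<lambda>i. t (Suc i))"
  define B where "B = binomial_transform t"
  define S where "S = binomial_transform s"
  define K :: complex where "K = of_nat k"
  have L: "L n x = B n" for n
    by (simp add: assms(6) L_poly_eq_binomial_transform B_def t_def)
  have term_rec: "of_real ((\<beta>1 + real i) * (\<beta>2 + real i) * (\<beta>3 + real i)) * s i
      = - (x * (of_real ((\<alpha>1 + real i) * (\<alpha>2 + real i)) * t i))" for i
  proof -
    have nz: "of_real \<beta> + of_nat i \<noteq> (0 :: complex)" if "\<beta> > 0" for \<beta> :: real
    proof -
      have "of_real (\<beta> + real i) \<noteq> (0 :: complex)"
        using that by (subst of_real_eq_0_iff) linarith
      then show ?thesis by simp
    qed
    \<comment> \<open>Here \<open>z\<close> stands for \<open>-x\<close>, and the local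
      \<open>b1\<close>, \<open>b2\<close>, \<open>b3\<close>, \<open>a1\<close>, \<open>a2\<close>
      for the last factors \<beta>j + i and \<alpha>j + i split off by
      \<open>pochhammer_Suc\<close>.\<close>
    have cancel: "b1 * b2 * b3 * (z ^ Suc i * (p1 * a1 * (p2 * a2)) / (q1 * b1 * (q2 * b2) * (q3 * b3)))
        = z * (a1 * a2 * (z ^ i * (p1 * p2) / (q1 * q2 * q3)))"
      if "b1 \<noteq> 0" "b2 \<noteq> 0" "b3 \<noteq> 0" for b1 b2 b3 z p1 p2 q1 q2 q3 a1 a2 :: complex
      using that by (simp add: mult_ac)
    show ?thesis
      unfolding s_def t_def pochhammer_Suc of_real_mult of_real_add of_real_of_nat_eq
        mult_minus_left[symmetric]
      by (rule cancel) (fact nz[OF assms(3)] nz[OF assms(4)] nz[OF assms(5)])+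
  qed
  have shift: "B (n + 1) - B n = S n" if "n \<ge> 0" for n
    unfolding B_def S_def s_def by (rule binomial_transform_diff_shift[OF that])
  have S0: "B (int k + 1) - B (int k) = S (int k)"
    by (rule shift) simp
  \<comment> \<open>In this and the next two facts, the prefactor vanishes for exactly those
    \<open>k\<close> where the index on the right is negative, so \<open>shift\<close> is needed
    only where it applies.\<close>
  have S1: "K * (B (int k) - B (int k - 1)) = K * S (int k - 1)"
    using shift[of "int k - 1"] by (cases "k = 0") (auto simp: K_def)
  have S2: "K * (K - 1) * (B (int k - 1) - B (int k - 2)) = K * (K - 1) * S (int k - 2)"
  proof (cases "k < 2")
    case True
    then show ?thesis by (auto simp: K_def less_2_cases_iff)
  next
    case False
    then show ?thesis using shift[of "int k - 2"] by simp
  qed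
  have S3: "K * (K - 1) * (K - 2) * (B (int k - 2) - B (int k - 3))
      = K * (K - 1) * (K - 2) * S (int k - 3)"
  proof (cases "k < 3")
    case True
    then have "k = 0 \<or> k = 1 \<or> k = 2" by linarith
    then show ?thesis by (auto simp: K_def)
  next
    case False
    then show ?thesis using shift[of "int k - 3"] by simp
  qed
  \<comment> \<open>The coefficients 1, 4, 6, 4, 1 split into first differences of \<open>B\<close>
    with weights 1, 3, 3, 1, up to sign; each difference is grouped with the prefactor that
    \<open>S1\<close>, \<open>S2\<close> or \<open>S3\<close> requires.\<close>
  have "(- K * (K - 1) * (K - 2) - K * (K - 1) * c - K * b_hat - d) * B (int k + 1)
     + (4 * K * (K - 1) * (K - 2) + 3 * K * (K - 1) * c + 2 * K * b_hat + d) * B (int k)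
     + (- 6 * K * (K - 1) * (K - 2) - 3 * K * (K - 1) * c - K * b_hat) * B (int k - 1)
     + (4 * K * (K - 1) * (K - 2) + K * (K - 1) * c) * B (int k - 2)
     - K * (K - 1) * (K - 2) * B (int k - 3)
    = - (K * (K - 1) * (K - 2) * (B (int k + 1) - B (int k))
          - 3 * ((K - 1) * (K - 2) * (K * (B (int k) - B (int k - 1))))
          + 3 * ((K - 2) * (K * (K - 1) * (B (int k - 1) - B (int k - 2))))
          - K * (K - 1) * (K - 2) * (B (int k - 2) - B (int k - 3))
        + c * (K * (K - 1) * (B (int k + 1) - B (int k))
          - 2 * ((K - 1) * (K * (B (int k) - B (int k - 1))))
          + K * (K - 1) * (B (int k - 1) - B (int k - 2)))
        + b_hat * (K * (B (int k + 1) - B (int k)) - K * (B (int k) - B (int k - 1)))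
        + d * (B (int k + 1) - B (int k)))"
    by (simp add: algebra_simps)
  also have "\<dots> = - (K * (K - 1) * (K - 2)
            * (S (int k) - 3 * S (int k - 1) + 3 * S (int k - 2) - S (int k - 3))
        + c * (K * (K - 1) * (S (int k) - 2 * S (int k - 1) + S (int k - 2)))
        + b_hat * (K * (S (int k) - S (int k - 1)))
        + d * S (int k))"
    unfolding S0 S1 S2 S3 by (simp add: algebra_simps)
  also have "\<dots> = - binomial_transform (\<lambda>i. of_nat i * (of_nat i - 1) * (of_nat i - 2) * s i
      + c * (of_nat i * (of_nat i - 1) * s i) + b_hat * (of_nat i * s i) + d * s i) (int k)"
    using binomial_transform_backward_diff[of "int k" s]
      binomial_transform_backward_diff2[of "int k" s]
      binomial_transform_backward_diff3[of "int k" s]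
    by (simp only: binomial_transform_add binomial_transform_cmult S_def K_def of_int_of_nat_eq)
  \<comment> \<open>The numbers 1, \<open>c\<close>, \<open>b_hat\<close>, \<open>d\<close> are the
    coefficients of (\<beta>1+i)(\<beta>2+i)(\<beta>3+i) in the falling factorial basis i(i-1)(i-2),
    i(i-1), i, 1.\<close>
  also have "(\<lambda>i. of_nat i * (of_nat i - 1) * (of_nat i - 2) * s i
      + c * (of_nat i * (of_nat i - 1) * s i) + b_hat * (of_nat i * s i) + d * s i)
      = (\<lambda>i. of_real ((\<beta>1 + real i) * (\<beta>2 + real i) * (\<beta>3 + real i)) * s i)"
    by (rule ext) (simp add: assms(7-12) algebra_simps)
  \<comment> \<open>After \<open>term_rec\<close>, the product (\<alpha>1+i)(\<alpha>2+i) is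
    expanded in the same basis, with coefficients 1, \<alpha>_hat, \<alpha>1 \<alpha>2; the
    difference rules then lead back to \<open>B\<close>.\<close>
  also have "\<dots> = (\<lambda>i. - x * (of_nat i * (of_nat i - 1) * t i + \<alpha>_hat * (of_nat i * t i)
      + (\<alpha>1 * \<alpha>2) * t i))"
    unfolding term_rec by (rule ext) (simp add: assms(13) algebra_simps)
  also have "- binomial_transform \<dots> (int k)
      = x * (K * (K - 1) * (B (int k) - 2 * B (int k - 1) + B (int k - 2))
        + \<alpha>_hat * (K * (B (int k) - B (int k - 1))) + (\<alpha>1 * \<alpha>2) * B (int k))"
    using binomial_transform_backward_diff[of "int k" t]
      binomial_transform_backward_diff2[of "int k" t]
    unfolding binomial_transform_add binomial_transform_cmult by (simp add: B_def K_def)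
  also have "\<dots> = x * ((K * (K - 1) + K * \<alpha>_hat + \<alpha>1 * \<alpha>2) * B (int k)
      - (2 * K * (K - 1) + K * \<alpha>_hat) * B (int k - 1) + K * (K - 1) * B (int k - 2))"
    by (simp add: algebra_simps)
  finally show ?thesis
    by (simp add: L K_def)
qed

end
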